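(* Let $d\ge 2$ and let $\mathfrak{w}:\mathbb{Z}_d\times\mathbb{Z}_d\to\mathbb{C}$ be a weight. The quantization map $f\mapsto A^{\mathfrak{w}}_f$ is covariant with respect to the action of $V$: for every $f:\mathbb{Z}_d\times\mathbb{Z}_d\to\mathbb{C}$, $s\in\mathbb{R}$ and $(m_0,n_0)\in\mathbb{Z}_d\times\mathbb{Z}_d$, $$V(s,m_0,n_0)\,A^{\mathfrak{w}}_f\,V(s,m_0,n_0)^\dagger=A^{\mathfrak{w}}_{\mathcal{V}(s,m_0,n_0)f},$$ where $(\mathcal{V}(s,m_0,n_0)f)(m,n)=f(m-m_0,n-n_0)$.
   Context: $\mathbb{Z}_d=\mathbb{Z}/d\mathbb{Z}$. $L^2(\mathbb{Z}_d)$ is the space of functions $\psi:\mathbb{Z}_d\to\mathbb{C}$ with $\langle\phi_1|\phi_2\rangle=\sum_{l\in\mathbb{Z}_d}\overline{\phi_1(l)}\phi_2(l)$. For $s\in\mathbb{R}$ and $(m,n)\in\mathbb{Z}_d\times\mathbb{Z}_d$, $V(s,m,n)$ is the unitary operator $(V(s,m,n)\psi)(l)=e^{\mathsf{i}\frac{2\pi}{d}s}\,\varepsilon(m,n)\,e^{\mathsf{i}\frac{2\pi}{d}ml}\,\psi(l-n)$ and $U(m,n)=V(0,m,n)$. Here $\varepsilon(m,n)$ is the phase denoted $e^{-\mathsf{i}\frac{\pi}{d}mn}$, with the following convention: if $d$ is odd, $\frac12$ is read as the inverse $\frac{d+1}{2}$ of $2$ in $\mathbb{Z}_d$, so $\varepsilon(m,n)=e^{-\mathsf{i}\frac{2\pi}{d}\frac{d+1}{2}mn}$;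 if $d$ is even, $m,n$ are represented by integers in $\{0,\dots,d-1\}$ and $\varepsilon(m,n)=e^{-\mathsf{i}\frac{\pi}{d}mn}$. For a weight $\mathfrak{w}$ (any complex function on $\mathbb{Z}_d\times\mathbb{Z}_d$), $\mathsf{M}^{\mathfrak{w}}=\frac1d\sum_{(m,n)}\mathfrak{w}(m,n)\,U(m,n)$, $\mathsf{M}^{\mathfrak{w}}(m,n)=U(m,n)\,\mathsf{M}^{\mathfrak{w}}\,U(m,n)^\dagger$, and for $f:\mathbb{Z}_d\times\mathbb{Z}_d\to\mathbb{C}$, $A^{\mathfrak{w}}_f=\frac1d\sum_{(m,n)\in\mathbb{Z}_d\times\mathbb{Z}_d}f(m,n)\,\mathsf{M}^{\mathfrak{w}}(m,n)$. *)

theory Defs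
  imports Complex_Main "Berlekamp_Zassenhaus.Finite_Field"
begin

text \<open>
  The ring of integers modulo \<open>d\<close> is \<^typ>\<open>'d mod_ring\<close>, with \<open>d = CARD('d)\<close>. The function
  \<^const>\<open>to_int_mod_ring\<close> picks the representative in \<open>{0, \<dots>, d - 1}\<close>. Operators on
  the Hilbert space of functions \<psi> are maps on functions.
\<close>

type_synonym 'd wavefn = "'d mod_ring \<Rightarrow> complex"
type_synonym 'd oper = "'d wavefn \<Rightarrow> 'd wavefn"

definition braket :: "'d::finite wavefn \<Rightarrow> 'd wavefn \<Rightarrow> complex" where
  "braket \<phi> \<psi> = (\<Sum>l\<in>UNIV. cnj (\<phi> l) * \<psi> l)"

text \<open>
  The Hermitian adjoint. It is meaningful for linear \<open>T\<close>, for which the described operator exists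
  by finite-dimensionality; the lemma below gives uniqueness.
\<close>

definition adj :: "'d::finite oper \<Rightarrow> 'd oper" where
  "adj T = (THE S. \<forall>\<phi> \<psi>. braket (T \<phi>) \<psi> = braket \<phi> (S \<psi>))"

lemma adj_eqI:
  fixes T S :: "'d::finite oper"
  assumes S: "\<And>\<phi> \<psi>. braket (T \<phi>) \<psi> = braket \<phi> (S \<psi>)"
  shows "adj T = S"
  unfolding adj_def
proof (rule the_equality)
  show "\<forall>\<phi> \<psi>. braket (T \<phi>) \<psi> = braket \<phi> (S \<psi>)"
    using S by blast
next
  fix R :: "'d oper"
  assume R: "\<forall>\<phi> \<psi>. braket (T \<phi>) \<psi> = braket \<phi> (R \<psi>)"
  have delta: "braket (\<lambda>k. if k = l then 1 else 0) \<chi> = \<chi> l" for l and \<chi> :: "'d wavefn"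
  proof -
    have "braket (\<lambda>k. if k = l then 1 else 0) \<chi> = (\<Sum>k\<in>UNIV. if k = l then \<chi> k else 0)"
      unfolding braket_def by (rule sum.cong) auto
    then show ?thesis by simp
  qed
  have "R \<psi> l = S \<psi> l" for \<psi> l
    using R S delta by metis
  then show "R = S" by (intro ext)
qed

text \<open>
  The phase written \<open>exp (- i \<pi> m n / d)\<close>: for odd \<open>d\<close>, one half is read as the inverse
  \<open>(d + 1) / 2\<close> of 2 modulo \<open>d\<close>; for even \<open>d\<close>, the value depends on the choice of
  representatives in \<open>{0, \<dots>, d - 1}\<close>.
\<close>

definition phase :: "'d::finite mod_ring \<Rightarrow> 'd mod_ring \<Rightarrow> complex" where
  "phase m n =
    (let mn = real_of_int (to_int_mod_ring m * to_int_mod_ring n); d = CARD('d) in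
     if odd d then cis (- (2 * pi / real d) * real ((d + 1) div 2) * mn)
     else cis (- (pi / real d) * mn))"

definition V :: "real \<Rightarrow> 'd::finite mod_ring \<Rightarrow> 'd mod_ring \<Rightarrow> 'd oper" where
  "V s m n \<psi> = (\<lambda>l. cis (2 * pi / real CARD('d) * s) * phase m n *
     cis (2 * pi / real CARD('d) * real_of_int (to_int_mod_ring m * to_int_mod_ring l)) *
     \<psi> (l - n))"

definition U :: "'d::finite mod_ring \<Rightarrow> 'd mod_ring \<Rightarrow> 'd oper" where
  "U m n = V 0 m n"

definition M :: "('d::finite mod_ring \<times> 'd mod_ring \<Rightarrow> complex) \<Rightarrow> 'd oper" where
  "M w \<psi> = (\<lambda>l. 1 / of_nat CARD('d) * (\<Sum>(m, n)\<in>UNIV. w (m, n) * U m n \<psi> l))"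

definition M_at ::
  "('d::finite mod_ring \<times> 'd mod_ring \<Rightarrow> complex) \<Rightarrow> 'd mod_ring \<Rightarrow> 'd mod_ring \<Rightarrow> 'd oper" where
  "M_at w m n = U m n \<circ> M w \<circ> adj (U m n)"

definition quantization ::
  "('d::finite mod_ring \<times> 'd mod_ring \<Rightarrow> complex) \<Rightarrow>
   ('d mod_ring \<times> 'd mod_ring \<Rightarrow> complex) \<Rightarrow> 'd oper" where
  "quantization w f \<psi> =
    (\<lambda>l. 1 / of_nat CARD('d) * (\<Sum>(m, n)\<in>UNIV. f (m, n) * M_at w m n \<psi> l))"

text \<open>The action on phase-space functions; the central parameter \<open>s\<close> acts trivially.\<close>

definition phase_space_action ::
  "real \<Rightarrow> 'd::finite mod_ring \<Rightarrow> 'd mod_ring \<Rightarrow>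
   ('d mod_ring \<times> 'd mod_ring \<Rightarrow> complex) \<Rightarrow> ('d mod_ring \<times> 'd mod_ring \<Rightarrow> complex)" where
  "phase_space_action s m\<^sub>0 n\<^sub>0 f = (\<lambda>(m, n). f (m - m\<^sub>0, n - n\<^sub>0))"

end

(* The Weyl operators form a projective representation of the group Z_d x Z_d: multiplying two of
   them adds the indices and produces a unimodular scalar. Conjugation is insensitive to that scalar,
   so conjugating M(m, n) by V(s, m0, n0) yields M(m + m0, n + n0), and the claim follows by linearity
   and translation of the summation index. Only the modulus of the phase \<epsilon>(m, n) matters. *)
theory Submission
  imports Defs
begin

text \<open>The standard additive character of the cyclic group; all computations with exponentials
  below go through its homomorphism law.\<close>

definition add_char :: "'d::finite mod_ring \<Rightarrow> complex" where
  "add_char x = cis (2 * pi / real CARD('d) * real_of_int (to_int_mod_ring x))"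

lemma norm_add_char [simp]: "norm (add_char x) = 1"
  by (simp add: add_char_def)

text \<open>Reducing \<open>k\<close> modulo d changes the angle by a multiple of 2 pi. This is what
  lets ring operations on representatives pass through \<open>cis\<close>.\<close>

lemma cis_mod_card:
  "cis (2 * pi / real CARD('d::finite) * real_of_int (k mod int CARD('d)))
    = cis (2 * pi / real CARD('d) * real_of_int k)"
proof -
  let ?d = "CARD('d)"
  have "real_of_int k = real ?d * real_of_int (k div int ?d) + real_of_int (k mod int ?d)"
    by (metis div_mult_mod_eq mult.commute of_int_add of_int_mult of_int_of_nat_eq)
  then have "2 * pi / real ?d * real_of_int k
      = 2 * pi * real_of_int (k div int ?d) + 2 * pi / real ?d * real_of_int (k mod int ?d)"
    by (simp add: field_simps)
  moreover have "cis (2 * pi * real_of_int (k div int ?d)) = 1"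
    by (rule cis_multiple_2pi) simp
  ultimately show ?thesis
    by (simp flip: cis_mult)
qed

lemma add_char_add:
  fixes x y :: "'d::finite mod_ring"
  shows "add_char (x + y) = add_char x * add_char y"
  unfolding add_char_def to_int_mod_ring_add cis_mod_card by (simp add: cis_mult distrib_left)

lemma add_char_mult:
  fixes x y :: "'d::finite mod_ring"
  shows "add_char (x * y) =
    cis (2 * pi / real CARD('d) * real_of_int (to_int_mod_ring x * to_int_mod_ring y))"
  unfolding add_char_def to_int_mod_ring_mult cis_mod_card ..

lemma add_char_0 [simp]: "add_char 0 = 1"
  by (simp add: add_char_def to_int_mod_ring_hom.hom_zero)

lemma add_char_minus: "add_char (- x) = cnj (add_char x)"
proof -
  have "add_char (- x) * add_char x = 1"
    by (simp flip: add_char_add)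
  moreover have "cnj (add_char x) * add_char x = 1"
    by (simp add: mult.commute[of "cnj _"] complex_norm_square[symmetric])
  ultimately show ?thesis
    by (metis mult_cancel_right mult_zero_right zero_neq_one)
qed

text \<open>The scalar is left free so that the family is closed under composition and adjoints
  without any identity for \<open>phase\<close>.\<close>

definition weyl :: "complex \<Rightarrow> 'd::finite mod_ring \<Rightarrow> 'd mod_ring \<Rightarrow> 'd oper" where
  "weyl c m n \<psi> = (\<lambda>l. c * add_char (m * l) * \<psi> (l - n))"

lemma V_eq_weyl:
  "V s m n = weyl (cis (2 * pi / real CARD('d) * s) * phase m n) (m :: 'd::finite mod_ring) n"
  by (simp add: fun_eq_iff V_def weyl_def add_char_mult)

lemma norm_phase [simp]: "norm (phase m n) = 1"
  by (simp add: phase_def Let_def)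

lemma weyl_scale: "weyl c m n (\<lambda>l. a * \<psi> l) = (\<lambda>l. a * weyl c m n \<psi> l)"
  by (simp add: weyl_def fun_eq_iff)

lemma weyl_sum: "weyl c m n (\<lambda>l. \<Sum>i\<in>I. g i l) = (\<lambda>l. \<Sum>i\<in>I. weyl c m n (g i) l)"
  by (simp add: weyl_def fun_eq_iff sum_distrib_left)

lemma weyl_mult_scalar: "weyl (a * c) m n \<psi> = (\<lambda>l. a * weyl c m n \<psi> l)"
  by (simp add: weyl_def fun_eq_iff)

text \<open>Moving the shift by \<open>n\<close> past the modulation by \<open>m'\<close> costs the
  factor \<open>add_char (- (m' * n))\<close>, the cocycle of the projective representation.\<close>

lemma weyl_comp_weyl:
  "weyl c m n \<circ> weyl c' m' n' = weyl (c * c' * add_char (- (m' * n))) (m + m') (n + n')"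
proof (intro ext)
  fix \<psi> l
  have "add_char (m * l) * add_char (m' * (l - n))
      = add_char (- (m' * n)) * add_char ((m + m') * l)"
    by (simp add: algebra_simps flip: add_char_add)
  then show "(weyl c m n \<circ> weyl c' m' n') \<psi> l
      = weyl (c * c' * add_char (- (m' * n))) (m + m') (n + n') \<psi> l"
    by (simp add: weyl_def diff_diff_eq)
qed

text \<open>Substituting \<open>l + n\<close> for \<open>l\<close> undoes the shift on the first
  argument; the character then splits off the constant \<open>add_char (m * n)\<close>.\<close>

lemma braket_weyl:
  "braket (weyl c m n \<phi>) \<psi> = braket \<phi> (weyl (cnj (c * add_char (m * n))) (- m) (- n) \<psi>)"
proof -
  have "braket (weyl c m n \<phi>) \<psi> = (\<Sum>l\<in>UNIV. cnj (weyl c m n \<phi> (l + n)) * \<psi> (l + n))"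
    unfolding braket_def
    by (rule sum.reindex_bij_witness[of _ "\<lambda>l. l + n" "\<lambda>l. l - n"]) auto
  also have "\<dots> = braket \<phi> (weyl (cnj (c * add_char (m * n))) (- m) (- n) \<psi>)"
    unfolding braket_def weyl_def
    by (rule sum.cong) (simp_all add: distrib_left add_char_add add_char_minus)
  finally show ?thesis .
qed

lemma adj_weyl: "adj (weyl c m n) = weyl (cnj (c * add_char (m * n))) (- m) (- n)"
  by (rule adj_eqI) (rule braket_weyl)

text \<open>The two factors cross the bracket one at a time, and uniqueness of the adjoint
  identifies the result.\<close>

lemma adj_weyl_comp_weyl:
  "adj (weyl c m n) \<circ> adj (weyl c' m' n') = adj (weyl c' m' n' \<circ> weyl c m n)"
  by (rule sym, rule adj_eqI) (simp add: braket_weyl adj_weyl)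

lemma adj_weyl_mult_scalar: "adj (weyl (a * c) m n) \<psi> = (\<lambda>l. cnj a * adj (weyl c m n) \<psi> l)"
  by (simp add: adj_weyl weyl_def fun_eq_iff)

lemma M_scale: "M w (\<lambda>l. a * \<psi> l) = (\<lambda>l. a * M w \<psi> l)"
  by (simp add: M_def U_def V_eq_weyl weyl_scale sum_distrib_left case_prod_unfold
      mult.left_commute fun_eq_iff)

text \<open>The ratio \<open>a\<close> of the scalars leaves the left factor as \<open>a\<close> and
  the adjoint as \<open>cnj a\<close>; the latter passes through the linear \<open>M w\<close>, and
  the two cancel because \<open>a\<close> is unimodular.\<close>

lemma weyl_conj_M:
  assumes "norm c = 1" "norm c' = 1"
  shows "weyl c m n \<circ> M w \<circ> adj (weyl c m n) = weyl c' m n \<circ> M w \<circ> adj (weyl c' m n)"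
proof -
  define a where "a = c / c'"
  have c: "c = a * c'" and a: "a * cnj a = 1"
    using assms by (auto simp: a_def complex_norm_square[symmetric] norm_divide)
  show ?thesis
    unfolding c
    by (simp add: fun_eq_iff adj_weyl_mult_scalar M_scale weyl_mult_scalar weyl_scale
        a flip: mult.assoc) (simp add: a mult.commute)
qed

lemma V_conj_M_at:
  "V s m\<^sub>0 n\<^sub>0 \<circ> M_at w m n \<circ> adj (V s m\<^sub>0 n\<^sub>0) = M_at w (m + m\<^sub>0) (n + n\<^sub>0)"
proof -
  have "V s m\<^sub>0 n\<^sub>0 \<circ> M_at w m n \<circ> adj (V s m\<^sub>0 n\<^sub>0)
      = (V s m\<^sub>0 n\<^sub>0 \<circ> U m n) \<circ> M w \<circ> (adj (U m n) \<circ> adj (V s m\<^sub>0 n\<^sub>0))"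
    by (simp add: M_at_def o_assoc)
  also have "\<dots> = U (m + m\<^sub>0) (n + n\<^sub>0) \<circ> M w \<circ> adj (U (m + m\<^sub>0) (n + n\<^sub>0))"
    \<comment> \<open>Both sides become conjugations by Weyl operators with equal indices, whose
      scalars are products of unimodular factors.\<close>
    unfolding U_def V_eq_weyl adj_weyl_comp_weyl weyl_comp_weyl add.commute[of m\<^sub>0] add.commute[of n\<^sub>0]
    by (rule weyl_conj_M) (simp_all add: norm_mult)
  finally show ?thesis
    by (simp add: M_at_def)
qed

theorem proposition4p10:
  fixes w f :: "'d::finite mod_ring \<times> 'd mod_ring \<Rightarrow> complex"
    and s :: real
    and m\<^sub>0 n\<^sub>0 :: "'d mod_ring"
  assumes "CARD('d) \<ge> 2"
  shows "V s m\<^sub>0 n\<^sub>0 \<circ> quantization w f \<circ> adj (V s m\<^sub>0 n\<^sub>0) =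
         quantization w (phase_space_action s m\<^sub>0 n\<^sub>0 f)"
proof (intro ext)
  fix \<psi> l
  let ?V = "V s m\<^sub>0 n\<^sub>0" and ?c = "1 / of_nat CARD('d) :: complex"
  have "(?V \<circ> quantization w f \<circ> adj ?V) \<psi> l
      = ?c * (\<Sum>(m, n)\<in>UNIV. f (m, n) * (?V \<circ> M_at w m n \<circ> adj ?V) \<psi> l)"
    \<comment> \<open>Linearity of \<open>?V\<close> moves it inside the sum; \<open>adj ?V\<close>
      only changes the argument \<open>\<psi>\<close>.\<close>
    by (simp only: o_def quantization_def V_eq_weyl weyl_scale weyl_sum case_prod_unfold)
  also have "\<dots> = ?c * (\<Sum>(m, n)\<in>UNIV. f (m, n) * M_at w (m + m\<^sub>0) (n + n\<^sub>0) \<psi> l)"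
    by (simp only: V_conj_M_at)
  also have "(\<Sum>(m, n)\<in>UNIV. f (m, n) * M_at w (m + m\<^sub>0) (n + n\<^sub>0) \<psi> l)
      = (\<Sum>(m, n)\<in>UNIV. phase_space_action s m\<^sub>0 n\<^sub>0 f (m, n) * M_at w m n \<psi> l)"
    by (rule sum.reindex_bij_witness[of _ "\<lambda>(m, n). (m - m\<^sub>0, n - n\<^sub>0)" "\<lambda>(m, n). (m + m\<^sub>0, n + n\<^sub>0)"])
      (auto simp: phase_space_action_def)
  finally show "(?V \<circ> quantization w f \<circ> adj ?V) \<psi> l
      = quantization w (phase_space_action s m\<^sub>0 n\<^sub>0 f) \<psi> l"
    by (simp add: quantization_def)
qed

end
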